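(* Let $a,b$ be positive real numbers and $x>0$. For each fixed $c>\max\{a,b\}$, $$\lim_{d\to\infty}\frac1d\,\mathcal{W}\!\left(\frac xd;a,b;c,d\right)=\mathcal{V}(x;a,b;c),$$ and, for each fixed $d>\max\{a,b\}$, $$\lim_{c\to\infty}\frac1c\,\mathcal{W}\!\left(\frac xc;a,b;c,d\right)=\mathcal{V}(x;a,b;d).$$
   Context: For positive reals $a,b,c,d$ with $\delta:=c+d-a-b>0$, the function $\mathcal{W}(\cdot\,;a,b;c,d)$ on $(0,1)$ is $$\mathcal{W}(x;a,b;c,d)=\frac{\Gamma(c)\Gamma(d)}{\Gamma(a)\Gamma(b)\Gamma(\delta)}\,x^{a-1}(1-x)^{\delta-1}\,{}_2F_1(c-b,d-b;\delta;1-x),$$ where ${}_2F_1(\alpha,\beta;\gamma;z)=\sum_{n\ge0}\frac{(\alpha)_n(\beta)_n}{(\gamma)_n}\frac{z^n}{n!}$ for $|z|<1$, with $(z)_n$ the Pochhammer symbol (rising factorial). For positive reals $a,b,c$ with $c>\max\{a,b\}$ and $x>0$, $$\mathcal{V}(x;a,b;c)=\frac{\Gamma(c)}{\Gamma(a)\Gamma(b)}\,e^{-x}x^{a-1}\,\mathbf{U}(c-b,a-b+1;x),$$ where $\mathbf{U}(\alpha,\beta;x)$ is the confluent hypergeometric function of the second kind (Tricomi function), which for $\alpha>0$, $x>0$ is $\mathbf{U}(\alpha,\beta;x)=\frac1{\Gamma(\alpha)}\int_0^\infty e^{-xt}t^{\alpha-1}(1+t)^{\beta-\alpha-1}\,\mathrm{d}t$.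 *)

theory Defs
  imports "HOL-Analysis.Analysis"
begin

text \<open>
  Real functions are total here, so each definition below carries its intended meaning only on
  the range of parameters stated with it; outside that range no meaning is attached.
\<close>

(* |z| < 1, and \<gamma> not a nonpositive integer *)
definition hyp2F1 :: "real \<Rightarrow> real \<Rightarrow> real \<Rightarrow> real \<Rightarrow> real" where
  "hyp2F1 \<alpha> \<beta> \<gamma> z =
     (\<Sum>n. pochhammer \<alpha> n * pochhammer \<beta> n / pochhammer \<gamma> n * (z ^ n / fact n))"

(* \<alpha> > 0 and x > 0, where the Lebesgue integral converges *)
definition tricomi_U :: "real \<Rightarrow> real \<Rightarrow> real \<Rightarrow> real" where
  "tricomi_U \<alpha> \<beta> x =
     1 / Gamma \<alpha> *
     (LBINT t:{0<..}. exp (- (x * t)) * t powr (\<alpha> - 1) * (1 + t) powr (\<beta> - \<alpha> - 1))"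

(* a, b, c, d > 0 with c + d - a - b > 0, and 0 < x < 1 *)
definition \<W> :: "real \<Rightarrow> real \<Rightarrow> real \<Rightarrow> real \<Rightarrow> real \<Rightarrow> real" where
  "\<W> x a b c d =
     (let \<delta> = c + d - a - b in
        Gamma c * Gamma d / (Gamma a * Gamma b * Gamma \<delta>) *
        x powr (a - 1) * (1 - x) powr (\<delta> - 1) *
        hyp2F1 (c - b) (d - b) \<delta> (1 - x))"

(* a, b > 0 with c > max a b, and x > 0 *)
definition \<V> :: "real \<Rightarrow> real \<Rightarrow> real \<Rightarrow> real \<Rightarrow> real" where
  "\<V> x a b c =
     Gamma c / (Gamma a * Gamma b) * exp (- x) * x powr (a - 1) *
     tricomi_U (c - b) (a - b + 1) x"

end

theory Submission
  imports Defs
begin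

text \<open>
  Expanding by the binomial series and integrating termwise turns the Euler integral of the
  hypergeometric function into an integral over the half-line: for \<open>0 < y < 1\<close>,
  \<open>F(p, b; q; 1 - y) = 1/B(p, q-p) * \<integral> s^(p-1) (1+s)^(b-q) (1 + y s)^(-b) ds\<close>.
  With \<open>y = x/d\<close> and second parameter \<open>d - b\<close>, the exponent of \<open>1 + s\<close> does not depend on \<open>d\<close>,
  while \<open>(1 + x s/d)^(b-d)\<close> tends to \<open>e^(-x s)\<close>, which gives the integral defining the Tricomi
  function. Bernoulli's inequality bounds \<open>(1 + x s/d)^(b-d)\<close> by a constant times
  \<open>(1 + s)^(-m)\<close>, so dominated convergence applies. The same limit, with \<open>B(a, d-a)\<close> written as
  such an integral, gives the asymptotics of \<open>\<Gamma>(d)/\<Gamma>(d-a)\<close>.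
\<close>

section \<open>Integrals over the half-line\<close>

text \<open>For a nonnegative function gauge integrability is already absolute, and Borel
  measurability allows passing from the completed measure to \<open>lborel\<close>, where limits and
  sums are exchanged with integrals below.\<close>

lemma set_integrable_lborel_of_has_integral:
  fixes f :: "real \<Rightarrow> real"
  assumes "(f has_integral v) S" and "\<And>s. s \<in> S \<Longrightarrow> f s \<ge> 0"
    and [measurable]: "f \<in> borel_measurable borel" "S \<in> sets borel"
  shows "set_integrable lborel S f" and "(LBINT s:S. f s) = v"
proof -
  have "f absolutely_integrable_on S"
    using assms(1,2) by (intro nonnegative_absolutely_integrable_1) (auto simp: has_integral_iff)
  then show *: "set_integrable lborel S f"
    unfolding set_integrable_def by (subst (asm) integrable_completion) auto
  show "(LBINT s:S. f s) = v"
    using set_borel_integral_eq_integral(2)[OF *] assms(1) by (simp add: has_integral_iff)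
qed

text \<open>Substitute t = s / (1 + s) in the Beta integral over (0, 1): then 1 - t = 1 / (1 + s)
  and dt = ds / (1 + s)^2.\<close>

lemma beta_prime_integral:
  fixes p q :: real
  assumes p: "p > 0" and q: "q > 0"
  shows "set_integrable lborel {0<..} (\<lambda>s. s powr (p - 1) * (1 + s) powr (- (p + q)))"
    and "(LBINT s:{0<..}. s powr (p - 1) * (1 + s) powr (- (p + q))) = Beta p q"
proof -
  let ?g = "\<lambda>s::real. s / (1 + s)"
  let ?f = "\<lambda>t. t powr (p - 1) * (1 - t) powr (q - 1)"
  have img: "?g ` {0<..} = {0<..<1}"
  proof safe
    fix t :: real assume "t \<in> {0<..<1}"
    then show "t \<in> ?g ` {0<..}"
      by (intro image_eqI[of _ _ "t / (1 - t)"]) (auto simp: field_simps)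
  qed auto
  have "?f absolutely_integrable_on {0<..<1} \<and> integral {0<..<1} ?f = Beta p q"
    using has_integral_Beta_real[OF p q, unfolded has_integral_Icc_iff_Ioo]
    by (intro conjI nonnegative_absolutely_integrable_1) (auto simp: has_integral_iff)
  then have "(\<lambda>s. \<bar>1 / (1 + s)\<^sup>2\<bar> * ?f (?g s)) absolutely_integrable_on {0<..} \<and>
      integral {0<..} (\<lambda>s. \<bar>1 / (1 + s)\<^sup>2\<bar> * ?f (?g s)) = Beta p q"
    unfolding img[symmetric]
    by (subst has_absolute_integral_change_of_variables_1')
       (auto intro!: derivative_eq_intros inj_onI simp: field_simps power2_eq_square)
  then have "((\<lambda>s. \<bar>1 / (1 + s)\<^sup>2\<bar> * ?f (?g s)) has_integral Beta p q) {0<..}"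
    by (auto simp: has_integral_iff set_lebesgue_integral_eq_integral)
  moreover have "\<bar>1 / (1 + s)\<^sup>2\<bar> * ?f (?g s) = s powr (p - 1) * (1 + s) powr (- (p + q))"
    if "s \<in> {0<..}" for s
  proof -
    have s: "s > 0" using that by simp
    then have "1 - s / (1 + s) = 1 / (1 + s)" by (simp add: field_simps)
    then have "\<bar>1 / (1 + s)\<^sup>2\<bar> * ?f (?g s) =
        s powr (p - 1) * ((1 + s) powr (- 2) / (1 + s) powr (p - 1) / (1 + s) powr (q - 1))"
      using s by (simp add: powr_divide powr_minus powr_numeral divide_simps)
    also have "\<dots> = s powr (p - 1) * (1 + s) powr (- (p + q))"
      by (simp flip: powr_diff)
    finally show ?thesis .
  qed
  ultimately have
    "((\<lambda>s. s powr (p - 1) * (1 + s) powr (- (p + q))) has_integral Beta p q) {0<..}"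
    by (metis (no_types, lifting) has_integral_cong)
  from set_integrable_lborel_of_has_integral[OF this]
  show "set_integrable lborel {0<..} (\<lambda>s. s powr (p - 1) * (1 + s) powr (- (p + q)))"
    and "(LBINT s:{0<..}. s powr (p - 1) * (1 + s) powr (- (p + q))) = Beta p q"
    by auto
qed

text \<open>The difference of the two sides vanishes at u = 0 and has derivative r ((1 + u)^(r-1) -
  1) \<ge> 0. The exponent is real because r = (d - b) / m in the application.\<close>

lemma Bernoulli_powr:
  fixes r u :: real
  assumes "r \<ge> 1" and "u \<ge> 0"
  shows "1 + r * u \<le> (1 + u) powr r"
proof -
  let ?h = "\<lambda>t. (1 + t) powr r - r * t"
  have "?h 0 \<le> ?h u"
  proof (rule DERIV_nonneg_imp_nondecreasing[OF assms(2)])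
    fix t :: real assume t: "0 \<le> t" "t \<le> u"
    have "(?h has_real_derivative r * (1 + t) powr (r - 1) - r) (at t)"
      using t by (auto intro!: derivative_eq_intros)
    moreover have "1 \<le> (1 + t) powr (r - 1)"
      using t assms by (intro ge_one_powr_ge_zero) auto
    then have "r * 1 \<le> r * (1 + t) powr (r - 1)"
      using assms by (intro mult_left_mono) auto
    ultimately show "\<exists>y. (?h has_real_derivative y) (at t) \<and> 0 \<le> y"
      by (intro exI[of _ "r * (1 + t) powr (r - 1) - r"]) auto
  qed
  then show ?thesis by simp
qed

text \<open>Bernoulli with exponent (d - b) / m bounds (1 + x s / d)^((d-b)/m) below by 1 + x s / (2
  m), as d \<ge> 2 b gives (d - b) / d \<ge> 1/2; the power -m then reverses the inequality. The
  constant is free of d and s, as a common majorant requires.\<close>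

lemma powr_bound_of_exponential_approx:
  fixes b d m s x :: real
  assumes "m > 0" "x > 0" "s \<ge> 0" "d > 0" "d \<ge> 2 * b" "d \<ge> b + m"
  shows "(1 + x / d * s) powr (- (d - b)) \<le> min 1 (x / (2 * m)) powr (- m) * (1 + s) powr (- m)"
proof -
  define k where "k = min 1 (x / (2 * m))"
  have k: "k > 0" "k \<le> 1" "k \<le> x / (2 * m)"
    using assms by (auto simp: k_def)
  have xs: "x / d * s \<ge> 0" using assms by simp
  \<comment> \<open>The two entries of the minimum serve the two terms: k \<le> 1 the constant one,
    k \<le> x / (2 m) the linear one.\<close>
  have "k * (1 + s) \<le> 1 + x / (2 * m) * s"
    using k assms mult_right_mono[of k "x / (2 * m)" s] by (simp add: algebra_simps)
  also have "x / (2 * m) * s \<le> (d - b) / m * (x / d * s)"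
  proof -
    have "1 / 2 \<le> (d - b) / d" using assms by (simp add: field_simps)
    then have "1 / 2 * (x / m * s) \<le> (d - b) / d * (x / m * s)"
      using assms by (intro mult_right_mono) auto
    then show ?thesis using assms by (simp add: field_simps)
  qed
  also have "1 + (d - b) / m * (x / d * s) \<le> (1 + x / d * s) powr ((d - b) / m)"
    using assms xs by (intro Bernoulli_powr) (auto simp: field_simps)
  finally have "k * (1 + s) \<le> (1 + x / d * s) powr ((d - b) / m)"
    by simp
  then have "((1 + x / d * s) powr ((d - b) / m)) powr (- m) \<le> (k * (1 + s)) powr (- m)"
    using k assms by (intro powr_mono2') auto
  also have "\<dots> = k powr (- m) * (1 + s) powr (- m)"
    using k assms by (intro powr_mult)
  finally show ?thesis
    using assms by (simp add: powr_powr k_def)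
qed

text \<open>Here m is the decay borrowed from the kernel: p < q + m makes s^(p-1) (1 + s)^(-(q+m))
  integrable, even when s^(p-1) (1 + s)^(-q) is not.\<close>

lemma tendsto_integral_exponential_kernel:
  fixes p q m x b :: real
  assumes "p > 0" "m > 0" "p < q + m" "x > 0"
  shows "((\<lambda>d. LBINT s:{0<..}. s powr (p - 1) * (1 + s) powr (- q) * (1 + x / d * s) powr (- (d - b)))
     \<longlongrightarrow> (LBINT s:{0<..}. s powr (p - 1) * (1 + s) powr (- q) * exp (- (x * s)))) at_top"
  unfolding set_lebesgue_integral_def
proof (rule integral_dominated_convergence_at_top)
  define K where "K = min 1 (x / (2 * m)) powr (- m)"
  let ?w = "\<lambda>s. K * (s powr (p - 1) * (1 + s) powr (- (p + (q + m - p))))"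
  have "set_integrable lborel {0<..} ?w"
    using assms by (intro set_integrable_mult_right beta_prime_integral) auto
  then show "integrable lborel (\<lambda>s. indicator {0<..} s *\<^sub>R ?w s)"
    by (simp add: set_integrable_def)
  show "\<forall>\<^sub>F d in at_top. AE s in lborel. norm (indicator {0<..} s *\<^sub>R (s powr (p - 1) *
      (1 + s) powr (- q) * (1 + x / d * s) powr (- (d - b)))) \<le> indicator {0<..} s *\<^sub>R ?w s"
    using eventually_gt_at_top[of 0] eventually_ge_at_top[of "2 * b"] eventually_ge_at_top[of "b + m"]
  proof eventually_elim
    case (elim d)
    have "s powr (p - 1) * (1 + s) powr (- q) * (1 + x / d * s) powr (- (d - b)) \<le> ?w s"
      if "s > 0" for s
    proof -
      have "s powr (p - 1) * (1 + s) powr (- q) * (1 + x / d * s) powr (- (d - b)) \<le>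
          s powr (p - 1) * (1 + s) powr (- q) * (K * (1 + s) powr (- m))"
        unfolding K_def using that elim assms
        by (intro mult_left_mono powr_bound_of_exponential_approx) auto
      also have "\<dots> = K * (s powr (p - 1) * ((1 + s) powr (- q) * (1 + s) powr (- m)))"
        by simp
      also have "\<dots> = ?w s"
        by (simp flip: powr_add)
      finally show ?thesis .
    qed
    then show ?case by (auto split: split_indicator)
  qed
  have "((\<lambda>d. (1 + x / d * s) powr (- (d - b))) \<longlongrightarrow> exp (- (x * s))) at_top" if "s > 0" for s
  proof -
    \<comment> \<open>The power -(d - b) splits into -d, which yields the exponential, and the fixed
      b, whose base tends to 1.\<close>
    have "((\<lambda>d. inverse ((1 + (x * s) / d) powr d) * (1 + (x * s) / d) powr b) \<longlongrightarrow>
        inverse (exp (x * s)) * (1 + 0) powr b) at_top"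
      by (intro tendsto_intros tendsto_exp_limit_at_top tendsto_divide_0[OF tendsto_const]
            filterlim_at_top_imp_at_infinity filterlim_ident) auto
    then show ?thesis
      by (simp add: exp_minus powr_diff powr_minus divide_simps)
  qed
  then show "AE s in lborel. ((\<lambda>d. indicator {0<..} s *\<^sub>R (s powr (p - 1) * (1 + s) powr (- q) *
      (1 + x / d * s) powr (- (d - b)))) \<longlongrightarrow>
      indicator {0<..} s *\<^sub>R (s powr (p - 1) * (1 + s) powr (- q) * exp (- (x * s)))) at_top"
    by (auto intro!: tendsto_intros split: split_indicator)
qed measurable

text \<open>Replacing s by s / d in the half-line integral for B(a, d - a) turns d^a B(a, d - a)
  into the integral of s^(a-1) (1 + s/d)^(-d), which tends to \<Gamma>(a). Dividing \<Gamma>(a) by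
  it gives the stated ratio.\<close>

lemma Gamma_ratio_tendsto:
  fixes a :: real
  assumes a: "a > 0"
  shows "((\<lambda>d. Gamma d / (d powr a * Gamma (d - a))) \<longlongrightarrow> 1) at_top"
proof -
  have lim: "(LBINT s:{0<..}. s powr (a - 1) * exp (- s)) = Gamma a"
  proof (rule set_integrable_lborel_of_has_integral)
    have "((\<lambda>t. t powr (a - 1) / exp t) has_integral Gamma a) {0<..}"
      using Gamma_integral_real[OF a]
      by (subst has_integral_spike_set_eq[of _ "{0..}"]) (auto intro: negligible_subset[of "{0}"])
    then show "((\<lambda>t. t powr (a - 1) * exp (- t)) has_integral Gamma a) {0<..}"
      by (simp add: exp_minus divide_inverse)
  qed auto
  have "(LBINT s:{0<..}. s powr (a - 1) * (1 + 1 / d * s) powr (- d)) = d powr a * Beta a (d - a)"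
    if d: "d > a" for d
  proof -
    have "d > 0" using a d by simp
    have scale: "(s / d) powr (a - 1) = d powr (- (a - 1)) * s powr (a - 1)" if "s > 0" for s
      using that \<open>d > 0\<close> powr_minus[of d "a - 1"] by (simp add: powr_divide field_simps)
    have "Beta a (d - a) = (LBINT s:{0<..}. s powr (a - 1) * (1 + s) powr (- d))"
      using beta_prime_integral(2)[of a "d - a"] a d by simp
    also have "\<dots> = 1 / d * (LBINT s. indicator {0<..} (s / d) *\<^sub>R
        ((s / d) powr (a - 1) * (1 + s / d) powr (- d)))"
      unfolding set_lebesgue_integral_def
      by (subst lborel_integral_real_affine[of "1 / d" _ 0]) (use \<open>d > 0\<close> in auto)
    also have "\<dots> = 1 / d * (LBINT s:{0<..}. d powr (- (a - 1)) *
        (s powr (a - 1) * (1 + 1 / d * s) powr (- d)))"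
      unfolding set_lebesgue_integral_def using \<open>d > 0\<close>
      by (intro arg_cong2[of _ _ _ _ "(*)"] Bochner_Integration.integral_cong refl)
         (auto simp: zero_less_divide_iff scale split: split_indicator)
    also have "\<dots> = d powr (- a) * (LBINT s:{0<..}. s powr (a - 1) * (1 + 1 / d * s) powr (- d))"
      using \<open>d > 0\<close> powr_add[of d "- 1" "- (a - 1)"]
      unfolding set_integral_mult_right by (simp add: powr_minus divide_inverse)
    finally show ?thesis
      using \<open>d > 0\<close> by (simp add: powr_minus)
  qed
  then have ev: "\<forall>\<^sub>F d in at_top. (LBINT s:{0<..}. s powr (a - 1) * (1 + 1 / d * s) powr (- d)) =
      d powr a * Beta a (d - a)"
    by (rule eventually_mono[OF eventually_gt_at_top[of a]])
  \<comment> \<open>The factor comes from taking q = 0 in the kernel limit. It is 1 for s > 0 but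
    not at s = -1, where \<open>0 powr 0 = 0\<close>, so the equality is taken on the half-line
    only.\<close>
  have drop: "(LBINT s:{0<..}. s powr (a - 1) * (1 + s) powr (- 0) * g s) =
      (LBINT s:{0<..}. s powr (a - 1) * g s)" for g :: "real \<Rightarrow> real"
    by (intro set_lebesgue_integral_cong) auto
  have "((\<lambda>d. LBINT s:{0<..}. s powr (a - 1) * (1 + 1 / d * s) powr (- d)) \<longlongrightarrow> Gamma a) at_top"
    \<comment> \<open>With p = a and q = 0 any m > a will do; m = 2 a is one choice.\<close>
    using tendsto_integral_exponential_kernel[of a "2 * a" 0 1 0, unfolded drop] a lim
    by simp
  then have "((\<lambda>d. d powr a * Beta a (d - a)) \<longlongrightarrow> Gamma a) at_top"
    by (rule Lim_transform_eventually[OF _ ev])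
  then have "((\<lambda>d. Gamma a / (d powr a * Beta a (d - a))) \<longlongrightarrow> Gamma a / Gamma a) at_top"
    using Gamma_real_pos[OF a, THEN less_imp_neq] by (intro tendsto_intros) auto
  moreover have "\<forall>\<^sub>F d in at_top. Gamma a / (d powr a * Beta a (d - a)) =
      Gamma d / (d powr a * Gamma (d - a))"
    using eventually_gt_at_top[of a]
  proof eventually_elim
    case (elim d)
    then show ?case
      using Gamma_real_pos[OF a, THEN less_imp_neq] by (simp add: Beta_def)
  qed
  ultimately show ?thesis
    using Gamma_real_pos[OF a, THEN less_imp_neq] by (simp add: Lim_transform_eventually)
qed

section \<open>The Euler integral and the limit of \<open>\<W>\<close>\<close>

text \<open>The signs of the generalized binomial coefficient and of (-z)^n cancel. In this form the
  terms are visibly nonnegative for b > 0 and z \<ge> 0, which termwise integration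
  exploits.\<close>

lemma binomial_series_pochhammer:
  fixes b z :: real
  assumes "\<bar>z\<bar> < 1"
  shows "(\<lambda>n. pochhammer b n / fact n * z ^ n) sums (1 - z) powr (- b)"
proof -
  have "((- b) gchoose n) * (- z) ^ n = pochhammer b n / fact n * z ^ n" for n
    by (simp add: gbinomial_pochhammer power_minus[of z])
  then show ?thesis
    using gen_binomial_real[of "- z" "- b"] assms by simp
qed

text \<open>With z = 1 - y one has 1 + y s = (1 + s) (1 - z s / (1 + s)). Expanding the last factor
  to the power -b gives terms that are Beta integrands with p + n in place of p, and B(p + n, q - p)
  = B(p, q - p) (p)_n / (q)_n supplies the hypergeometric coefficients.\<close>

lemma hyp2F1_Euler_integral:
  fixes p b q y :: real
  assumes p: "p > 0" and b: "b > 0" and q: "p < q" and y: "0 < y" "y < 1"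
  shows "hyp2F1 p b q (1 - y) = 1 / Beta p (q - p) *
    (LBINT s:{0<..}. s powr (p - 1) * (1 + s) powr (b - q) * (1 + y * s) powr (- b))"
proof -
  define z where "z = 1 - y"
  have z: "0 < z" "z < 1" using y by (auto simp: z_def)
  define B where "B = Beta p (q - p)"
  have B: "B > 0" using p q by (auto simp: B_def Beta_def Gamma_real_pos)
  let ?t = "\<lambda>n. pochhammer b n / fact n * z ^ n"
  let ?k = "\<lambda>n s. s powr (p + real n - 1) * (1 + s) powr (- (p + real n + (q - p)))"
  let ?f = "\<lambda>n s. indicator {0<..} s *\<^sub>R (?t n * ?k n s)"
  have t0: "?t n \<ge> 0" for n using b z by (simp add: pochhammer_nonneg)
  have ratio: "Beta (p + real n) (q - p) = B * (pochhammer p n / pochhammer q n)" for n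
    using p q Gamma_real_pos[of p] Gamma_real_pos[of q] Gamma_real_pos[of "p + n"]
    by (simp add: B_def Beta_def pochhammer_Gamma nonpos_Ints_def add_ac order.strict_iff_not)
  have int: "integrable lborel (?f n)" for n
    using set_integrable_mult_right[OF beta_prime_integral(1)[of "p + real n" "q - p"], of "?t n"] p q
    by (simp add: set_integrable_def)
  have val: "integral\<^sup>L lborel (?f n) = ?t n * (B * (pochhammer p n / pochhammer q n))" for n
    using beta_prime_integral(2)[of "p + real n" "q - p"] p q
    unfolding set_lebesgue_integral_def[symmetric] set_integral_mult_right by (simp add: ratio)
  \<comment> \<open>Since p < q, the series of integrals is dominated by B times the binomial series
    at z < 1.\<close>
  have le1: "pochhammer p n / pochhammer q n \<le> 1" "0 \<le> pochhammer p n / pochhammer q n" for n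
  proof -
    have "pochhammer p n \<le> pochhammer q n"
      unfolding pochhammer_prod using p q by (intro prod_mono) auto
    then show "pochhammer p n / pochhammer q n \<le> 1" "0 \<le> pochhammer p n / pochhammer q n"
      using p q pochhammer_pos[of q n] pochhammer_pos[of p n] by auto
  qed
  have summ: "summable (\<lambda>n. ?t n * (B * (pochhammer p n / pochhammer q n)))"
  proof (rule summable_comparison_test')
    show "summable (\<lambda>n. ?t n * B)"
      using binomial_series_pochhammer[of z b] z by (intro summable_mult2) (auto simp: sums_iff)
    show "norm (?t n * (B * (pochhammer p n / pochhammer q n))) \<le> ?t n * B" if "n \<ge> 0" for n
    proof -
      have "B * (pochhammer p n / pochhammer q n) \<le> B * 1"
        using le1[of n] B by (intro mult_left_mono) auto
      then have "?t n * (B * (pochhammer p n / pochhammer q n)) \<le> ?t n * B"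
        using t0[of n] by (intro mult_left_mono) auto
      moreover have "0 \<le> ?t n * (B * (pochhammer p n / pochhammer q n))"
        using B by (intro mult_nonneg_nonneg[OF t0] mult_nonneg_nonneg[OF _ le1(2)]) simp
      ultimately show ?thesis by (simp only: real_norm_def abs_of_nonneg)
    qed
  qed
  have pt: "(\<lambda>n. ?t n * ?k n s) sums
      (s powr (p - 1) * (1 + s) powr (b - q) * (1 + y * s) powr (- b))" if s: "s > 0" for s
  proof -
    have "z * (s / (1 + s)) < 1 * 1" using z s by (intro mult_strict_mono) auto
    then have series: "(\<lambda>n. s powr (p - 1) * (1 + s) powr (- q) *
        (pochhammer b n / fact n * (z * (s / (1 + s))) ^ n)) sums
       (s powr (p - 1) * (1 + s) powr (- q) * (1 - z * (s / (1 + s))) powr (- b))"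
      using z s by (intro sums_mult binomial_series_pochhammer) auto
    have coeff: "s powr (p - 1) * (1 + s) powr (- q) *
        (pochhammer b n / fact n * (z * (s / (1 + s))) ^ n) = ?t n * ?k n s" for n
    proof -
      have "s powr (p + real n - 1) = s powr (p - 1) * s ^ n"
        using s powr_add[of s "p - 1" "real n"] by (simp add: powr_realpow algebra_simps)
      moreover have "(1 + s) powr (- (p + real n + (q - p))) = (1 + s) powr (- q) / (1 + s) ^ n"
        using s powr_diff[of "1 + s" "- q" "real n"] by (simp add: powr_realpow algebra_simps)
      ultimately show ?thesis by (simp add: power_mult_distrib power_divide)
    qed
    have base: "(1 - z * (s / (1 + s))) powr (- b) = (1 + s) powr b * (1 + y * s) powr (- b)"
    proof -
      have "1 - z * (s / (1 + s)) = (1 + y * s) / (1 + s)"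
        using s by (simp add: z_def field_simps)
      then show ?thesis using s y by (simp only: powr_divide powr_minus) (simp add: field_simps powr_divide)
    qed
    have "(1 + s) powr (b - q) = (1 + s) powr (- q) * (1 + s) powr b"
      by (simp flip: powr_add)
    then show ?thesis
      using series unfolding coeff base by (simp only: mult.assoc)
  qed
  \<comment> \<open>By nonnegativity, the absolute summability needed to exchange sum and integral
    is the summability already obtained.\<close>
  have nrm: "norm (?f n s) = ?f n s" for n s
    unfolding real_norm_def real_scaleR_def
    by (intro abs_of_nonneg mult_nonneg_nonneg[OF _ mult_nonneg_nonneg[OF t0]]) auto
  have sm: "summable (\<lambda>n. norm (?f n s))" for s
    unfolding nrm using pt[of s] by (auto simp: sums_iff split: split_indicator)
  have "(\<lambda>n. integral\<^sup>L lborel (?f n)) sums (\<integral>s. (\<Sum>n. ?f n s) \<partial>lborel)"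
  proof (rule sums_integral[OF int])
    show "summable (\<lambda>n. \<integral>s. norm (?f n s) \<partial>lborel)"
      using summ by (simp only: nrm val)
  qed (use sm in auto)
  also have "(\<integral>s. (\<Sum>n. ?f n s) \<partial>lborel) =
      (LBINT s:{0<..}. s powr (p - 1) * (1 + s) powr (b - q) * (1 + y * s) powr (- b))"
    unfolding set_lebesgue_integral_def using pt
    by (intro Bochner_Integration.integral_cong) (auto simp: sums_iff split: split_indicator)
  finally have "(\<Sum>n. ?t n * (B * (pochhammer p n / pochhammer q n))) =
      (LBINT s:{0<..}. s powr (p - 1) * (1 + s) powr (b - q) * (1 + y * s) powr (- b))"
    by (simp only: val sums_iff)
  moreover have "(\<Sum>n. ?t n * (B * (pochhammer p n / pochhammer q n))) = B * hyp2F1 p b q z"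
    unfolding hyp2F1_def
  proof (subst suminf_mult[symmetric])
    show "summable (\<lambda>n. pochhammer p n * pochhammer b n / pochhammer q n * (z ^ n / fact n))"
      using summable_mult[OF summ, of "1 / B"] B by (simp add: field_simps)
  qed (simp add: field_simps)
  ultimately show ?thesis
    using B by (simp add: B_def[symmetric] z_def[symmetric])
qed

text \<open>Exchanging c and d fixes \<delta> and swaps the upper parameters c - b and d - b, in
  which the series is symmetric. This reduces the second limit to the first.\<close>

lemma \<W>_commute: "\<W> x a b c d = \<W> x a b d c"
  by (simp add: \<W>_def hyp2F1_def Let_def add.commute mult.commute)

text \<open>In the Euler integral \<Gamma>(c + d - a - b) cancels, leaving \<Gamma>(d) / \<Gamma>(d
  - a), of order d^a; this balances (1/d) (x/d)^(a-1) = x^(a-1) / d^a. The factor exp(-x) comes from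
  (1 - x/d)^(\<delta>-1).\<close>

lemma \<W>_tendsto_\<V>:
  fixes a b c x :: real
  assumes a: "a > 0" and b: "b > 0" and x: "x > 0" and c: "c > max a b"
  shows "((\<lambda>d. 1 / d * \<W> (x / d) a b c d) \<longlongrightarrow> \<V> x a b c) at_top"
proof -
  define I where "I = (\<lambda>d. LBINT s:{0<..}. s powr (c - b - 1) * (1 + s) powr (- (c - a)) *
      (1 + x / d * s) powr (- (d - b)))"
  define A where "A = Gamma c / (Gamma a * Gamma b * Gamma (c - b)) * x powr (a - 1)"
  let ?R = "\<lambda>d. A * (Gamma d / (d powr a * Gamma (d - a))) *
      ((1 + (- x) / d) powr d * (1 + (- x) / d) powr (c - a - b - 1)) * I d"
  have "(I \<longlongrightarrow> (LBINT s:{0<..}. s powr (c - b - 1) * (1 + s) powr (- (c - a)) * exp (- (x * s)))) at_top"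
    unfolding I_def using a b c x
    \<comment> \<open>For m = a the condition p < q + m reads c - b < c, that is b > 0.\<close>
    by (intro tendsto_integral_exponential_kernel[where m = a]) auto
  also have "(LBINT s:{0<..}. s powr (c - b - 1) * (1 + s) powr (- (c - a)) * exp (- (x * s))) =
      Gamma (c - b) * tricomi_U (c - b) (a - b + 1) x"
    using c Gamma_real_pos[of "c - b", THEN less_imp_neq] by (auto simp: tricomi_U_def mult_ac)
  finally have "(?R \<longlongrightarrow> A * 1 * (exp (- x) * (1 + 0) powr (c - a - b - 1)) *
      (Gamma (c - b) * tricomi_U (c - b) (a - b + 1) x)) at_top"
    by (intro tendsto_intros Gamma_ratio_tendsto a tendsto_exp_limit_at_top
          tendsto_divide_0[OF tendsto_const] filterlim_at_top_imp_at_infinity filterlim_ident) auto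
  also have "A * 1 * (exp (- x) * (1 + 0) powr (c - a - b - 1)) *
      (Gamma (c - b) * tricomi_U (c - b) (a - b + 1) x) = \<V> x a b c"
    using c Gamma_real_pos[of "c - b", THEN less_imp_neq] by (simp add: A_def \<V>_def)
  finally have lim: "(?R \<longlongrightarrow> \<V> x a b c) at_top" .
  \<comment> \<open>The Euler integral needs d > x for 0 < x/d < 1, d > b for a positive second
    parameter, and d > a for c - b < c + d - a - b.\<close>
  have "\<forall>\<^sub>F d in at_top. ?R d = 1 / d * \<W> (x / d) a b c d"
    using eventually_gt_at_top[of 0] eventually_gt_at_top[of x] eventually_gt_at_top[of a]
      eventually_gt_at_top[of b]
  proof eventually_elim
    case (elim d)
    have F: "hyp2F1 (c - b) (d - b) (c + d - a - b) (1 - x / d) =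
        1 / Beta (c - b) (d - a) * I d"
      using hyp2F1_Euler_integral[of "c - b" "d - b" "c + d - a - b" "x / d"] a b c x elim
      by (simp add: I_def algebra_simps)
    have B: "Beta (c - b) (d - a) = Gamma (c - b) * Gamma (d - a) / Gamma (c + d - a - b)"
      by (simp add: Beta_def algebra_simps)
    have pw: "(1 - x / d) powr (c + d - a - b - 1) = (1 - x / d) powr d * (1 - x / d) powr (c - a - b - 1)"
      by (simp add: algebra_simps flip: powr_add)
    have xd: "1 / d * (x / d) powr (a - 1) = x powr (a - 1) / d powr a"
      using elim x by (simp add: powr_divide powr_diff)
    have "Gamma (c + d - a - b) \<noteq> 0"
      using c elim Gamma_real_pos[of "c + d - a - b", THEN less_imp_neq] by simp
    then have "Gamma c * Gamma d / (Gamma a * Gamma b * Gamma (c + d - a - b)) *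
        (1 / Beta (c - b) (d - a) * I d) =
        Gamma c * Gamma d / (Gamma a * Gamma b * Gamma (c - b) * Gamma (d - a)) * I d"
      by (simp add: B)
    moreover have "1 / d * \<W> (x / d) a b c d = (1 / d * (x / d) powr (a - 1)) *
        (1 - x / d) powr (c + d - a - b - 1) *
        (Gamma c * Gamma d / (Gamma a * Gamma b * Gamma (c + d - a - b)) *
        (1 / Beta (c - b) (d - a) * I d))"
      unfolding \<W>_def Let_def F by (simp only: mult_ac)
    ultimately have "1 / d * \<W> (x / d) a b c d = (1 / d * (x / d) powr (a - 1)) *
        (1 - x / d) powr (c + d - a - b - 1) *
        (Gamma c * Gamma d / (Gamma a * Gamma b * Gamma (c - b) * Gamma (d - a)) * I d)"
      by (simp only:)
    then show ?case
      unfolding xd pw A_def by (simp add: mult_ac)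
  qed
  then show ?thesis
    by (rule Lim_transform_eventually[OF lim])
qed

theorem mainTheorem12:
  fixes a b x :: real
  assumes "a > 0" and "b > 0" and "x > 0"
  shows "(\<forall>c>max a b. ((\<lambda>d. 1 / d * \<W> (x / d) a b c d) \<longlongrightarrow> \<V> x a b c) at_top) \<and>
         (\<forall>d>max a b. ((\<lambda>c. 1 / c * \<W> (x / c) a b c d) \<longlongrightarrow> \<V> x a b d) at_top)"
  using \<W>_tendsto_\<V>[OF assms] by (simp add: \<W>_commute[of _ a b _ d for d])

end
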